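(* Let $f(ct,x^\alpha,\epsilon^\alpha)$, $\epsilon^\alpha=v^\alpha/c$, be a spatial Lagrangian with the (formal) expansion $$f=\sum_{I=0}^\infty\frac1{I!}\sum_{J=0}^\infty\frac1{c^J}\,\bar f^{(J)}_{\alpha_1\dots\alpha_I}(t,x)\,\epsilon^{\alpha_1}\cdots\epsilon^{\alpha_I},$$ where the coefficients $\bar f^{(J)}_{\alpha_1\dots\alpha_I}$ are totally symmetric and independent of $c$, and where the matrix $\bar f^{(0)}_{\alpha\beta}$ is invertible with inverse $\bar f^{(0)\,\alpha\beta}$. For $J\geq-2$ set $$G^{(J)}_\beta=\sum_{I=0}^{J+2}\frac1{I!}\,\partial_\beta\bar f^{(J-I+2)}_{\alpha_1\dots\alpha_I}v^{\alpha_1}\cdots v^{\alpha_I}-\sum_{I=0}^{J+1}\frac1{I!}\left(\partial_t\bar f^{(J-I+1)}_{\beta\alpha_1\dots\alpha_I}+v^\gamma\partial_\gamma\bar f^{(J-I+1)}_{\beta\alpha_1\dots\alpha_I}\right)v^{\alpha_1}\cdots v^{\alpha_I}$$ (the second sum being empty for $J=-2$). Suppose $G^{(-2)}_\alpha=0$ and $G^{(-1)}_\alpha=0$. Then the spatial acceleration equation $$f_{\alpha\beta}\frac{d^2x^\alpha}{dt^2}=c^2\partial_\beta f-c\,(\partial_tf_\beta+v^\gamma\partial_\gamma f_\beta)$$ takes, to order $c^{-2}$, the form $$\frac{d^2x^\beta}{dt^2}=\bar f^{(0)\,\alpha\beta}G^{(0)}_\alpha+\frac1c\left(\bar f^{(0)\,\alpha\beta}G^{(1)}_\alpha+q^{(1)\,\alpha\beta}G^{(0)}_\alpha\right)+\frac1{c^2}\left(\bar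 f^{(0)\,\alpha\beta}G^{(2)}_\alpha+q^{(1)\,\alpha\beta}G^{(1)}_\alpha+q^{(2)\,\alpha\beta}G^{(0)}_\alpha\right)+\mathcal O(c^{-3}),$$ where $$q^{(1)\,\sigma\gamma}=-\bar f^{(0)\,\sigma\beta}\bar f^{(0)\,\alpha\gamma}\left(\bar f^{(1)}_{\alpha\beta}+\bar f^{(0)}_{\alpha\beta\alpha_1}v^{\alpha_1}\right),$$ $$q^{(2)\,\sigma\gamma}=\bar f^{(0)}_{\alpha\lambda}\,q^{(1)\,\alpha\gamma}q^{(1)\,\sigma\lambda}-\bar f^{(0)\,\sigma\beta}\bar f^{(0)\,\alpha\gamma}\left(\bar f^{(2)}_{\alpha\beta}+\bar f^{(1)}_{\alpha\beta\alpha_1}v^{\alpha_1}+\tfrac12\bar f^{(0)}_{\alpha\beta\alpha_1\alpha_2}v^{\alpha_1}v^{\alpha_2}\right).$$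
   Context: Greek indices run over $1,2,3$ and repeated indices are summed. $c$ is the speed of light, used as (inverse) expansion parameter; expansions are understood as formal power series in $1/c$ at fixed $(t,x^\alpha,v^\alpha)$. $v^\alpha=dx^\alpha/dt$. Subscripts on $f$ denote derivatives with respect to $\epsilon$: $f_\alpha=\partial f/\partial\epsilon^\alpha$, $f_{\alpha\beta}=\partial^2f/\partial\epsilon^\alpha\partial\epsilon^\beta$, evaluated at $\epsilon^\alpha=v^\alpha/c$; $\partial_t=\partial/\partial t$ and $\partial_\gamma=\partial/\partial x^\gamma$ are taken at fixed $\epsilon$. The superscript $(J)$ labels the order in $1/c$. The spatial Lagrangian is the function $f(ct,x^\alpha,\epsilon^\alpha)=F(ct,x^\alpha,1,\epsilon^\alpha)$ obtained from a parametrization-invariant point-particle action $Mc\int F(x,\dot x)\,d\tau$, with $F$ positively $1$-homogeneous in $\dot x$, in coordinates $x^a=(ct,x^\alpha)$. *)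

theory Defs
  imports
    "HOL-Analysis.Analysis"
    "HOL-Computational_Algebra.Formal_Laurent_Series"
    "HOL-Library.Multiset"
begin

definition partial_deriv :: "3 \<Rightarrow> (real^3 \<Rightarrow> real) \<Rightarrow> real^3 \<Rightarrow> real" where
  "partial_deriv \<alpha> g y = deriv (\<lambda>s. g (y + s *\<^sub>R axis \<alpha> 1)) 0"

text \<open>
  A formal series \<open>\<phi> = \<Sum>\<^sub>J \<Sum>\<^sub>I c\<^sup>-\<^sup>J \<phi>\<^sub>J\<^sub>,\<^sub>I(t,x,\<epsilon>)\<close> is represented by its terms
  \<open>\<phi> J I t x \<epsilon>\<close>, where the term with index \<open>I\<close> is a homogeneous polynomial of degree \<open>I\<close>
  in \<open>\<epsilon>\<close>. Here \<open>\<epsilon>\<close> is independent of \<open>c\<close>; the relation \<open>\<epsilon> = v/c\<close> is only imposed by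
  \<open>at_velocity\<close> below. Position is given by \<open>(t, x)\<close>, i.e. the argument \<open>ct\<close> is written
  as a function of \<open>t\<close>.
\<close>

type_synonym formal_fun = "nat \<Rightarrow> nat \<Rightarrow> real \<Rightarrow> real^3 \<Rightarrow> real^3 \<Rightarrow> real"

text \<open>
  Derivatives are taken term by term; \<open>d_eps\<close> lowers the degree in \<open>\<epsilon>\<close>, hence the index shift.
\<close>

definition d_eps :: "3 \<Rightarrow> formal_fun \<Rightarrow> formal_fun" where
  "d_eps \<alpha> \<phi> = (\<lambda>J I t x e. partial_deriv \<alpha> (\<lambda>e'. \<phi> J (Suc I) t x e') e)"

definition d_x :: "3 \<Rightarrow> formal_fun \<Rightarrow> formal_fun" where
  "d_x \<alpha> \<phi> = (\<lambda>J I t x e. partial_deriv \<alpha> (\<lambda>x'. \<phi> J I t x' e) x)"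

definition d_t :: "formal_fun \<Rightarrow> formal_fun" where
  "d_t \<phi> = (\<lambda>J I t x e. deriv (\<lambda>t'. \<phi> J I t' x e) t)"

text \<open>
  Formal Laurent series in \<open>1/c\<close>: the series variable \<open>fls_X\<close> is \<open>1/c\<close> and \<open>fls_X_inv\<close> is \<open>c\<close>.
  Evaluation at \<open>\<epsilon> = v/c\<close> uses \<open>c\<^sup>-\<^sup>J \<phi>\<^sub>J\<^sub>,\<^sub>I(t,x,v/c) = c\<^sup>-\<^sup>J\<^sup>-\<^sup>I \<phi>\<^sub>J\<^sub>,\<^sub>I(t,x,v)\<close>.
\<close>

definition at_velocity :: "formal_fun \<Rightarrow> real \<Rightarrow> real^3 \<Rightarrow> real^3 \<Rightarrow> real fls" where
  "at_velocity \<phi> t x v = fps_to_fls (Abs_fps (\<lambda>n. \<Sum>I\<le>n. \<phi> (n - I) I t x v))"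

definition is_O_c :: "int \<Rightarrow> real fls \<Rightarrow> bool" where
  "is_O_c k w \<longleftrightarrow> (\<forall>n<k. fls_nth w n = 0)"

text \<open>
  The homogeneous Lagrangian \<open>F(x, x')\<close>, \<open>x' = (u0, u)\<close>, is expanded like \<open>f\<close>, in \<open>1/c\<close> and in
  the degree in the spatial components \<open>u\<close>. Scaling \<open>(u0, u)\<close> preserves the degree in \<open>u\<close>, so
  homogeneity of \<open>F\<close> is homogeneity of every term.
\<close>

type_synonym formal_lagrangian =
  "nat \<Rightarrow> nat \<Rightarrow> real \<Rightarrow> real^3 \<Rightarrow> real \<Rightarrow> real^3 \<Rightarrow> real"

definition pos_homogeneous :: "formal_lagrangian \<Rightarrow> bool" where
  "pos_homogeneous F \<longleftrightarrow>
     (\<forall>J I t x u0 u k. u0 > 0 \<longrightarrow> k > 0 \<longrightarrow> F J I t x (k * u0) (k *\<^sub>R u) = k * F J I t x u0 u)"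

definition spatial_lagrangian :: "formal_lagrangian \<Rightarrow> formal_fun" where
  "spatial_lagrangian F = (\<lambda>J I t x e. F J I t x 1 e)"

text \<open>The unknown \<open>a\<close> is the acceleration at given \<open>(t,x,v)\<close>, as a formal series in \<open>1/c\<close>.\<close>

definition acceleration_eq ::
    "formal_fun \<Rightarrow> real \<Rightarrow> real^3 \<Rightarrow> real^3 \<Rightarrow> (real fls)^3 \<Rightarrow> bool" where
  "acceleration_eq f t x v a \<longleftrightarrow>
     (\<forall>\<beta>. (\<Sum>\<alpha>\<in>UNIV. at_velocity (d_eps \<alpha> (d_eps \<beta> f)) t x v * a $ \<alpha>) =
        fls_X_inv ^ 2 * at_velocity (d_x \<beta> f) t x v
        - fls_X_inv * (at_velocity (d_t (d_eps \<beta> f)) t x v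
            + (\<Sum>\<gamma>\<in>UNIV. fls_const (v $ \<gamma>) * at_velocity (d_x \<gamma> (d_eps \<beta> f)) t x v)))"

text \<open>
  \<open>fb J [\<alpha>\<^sub>1,\<dots>,\<alpha>\<^sub>I] t x\<close> is the coefficient with upper label \<open>(J)\<close> and lower indices
  \<open>\<alpha>\<^sub>1, \<dots>, \<alpha>\<^sub>I\<close>; the length of the index list is the rank.
\<close>

type_synonym coeffs = "nat \<Rightarrow> 3 list \<Rightarrow> real \<Rightarrow> real^3 \<Rightarrow> real"

definition totally_symmetric :: "coeffs \<Rightarrow> bool" where
  "totally_symmetric fb \<longleftrightarrow> (\<forall>J as bs t x. mset as = mset bs \<longrightarrow> fb J as t x = fb J bs t x)"

definition contract :: "nat \<Rightarrow> (3 list \<Rightarrow> real) \<Rightarrow> real^3 \<Rightarrow> real" where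
  "contract I T v = (\<Sum>as | length as = I. T as * (\<Prod>\<alpha>\<leftarrow>as. v $ \<alpha>))"

definition f2_matrix :: "coeffs \<Rightarrow> real \<Rightarrow> real^3 \<Rightarrow> real^3^3" where
  "f2_matrix fb t x = (\<chi> \<alpha> \<beta>. fb 0 [\<alpha>, \<beta>] t x)"

definition f2_inv :: "coeffs \<Rightarrow> real \<Rightarrow> real^3 \<Rightarrow> 3 \<Rightarrow> 3 \<Rightarrow> real" where
  "f2_inv fb t x \<alpha> \<beta> = matrix_inv (f2_matrix fb t x) $ \<alpha> $ \<beta>"

text \<open>Only used for \<open>J \<ge> -2\<close>; then all arguments of \<open>nat\<close> below are nonnegative.\<close>

definition G :: "coeffs \<Rightarrow> real \<Rightarrow> real^3 \<Rightarrow> real^3 \<Rightarrow> int \<Rightarrow> 3 \<Rightarrow> real" where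
  "G fb t x v J \<beta> =
     (\<Sum>I | int I \<le> J + 2. 1 / fact I *
        contract I (\<lambda>as. partial_deriv \<beta> (fb (nat (J - int I + 2)) as t) x) v)
     - (\<Sum>I | int I \<le> J + 1. 1 / fact I *
        contract I (\<lambda>as. deriv (\<lambda>t'. fb (nat (J - int I + 1)) (\<beta> # as) t' x) t
          + (\<Sum>\<gamma>\<in>UNIV. v $ \<gamma> * partial_deriv \<gamma> (fb (nat (J - int I + 1)) (\<beta> # as) t) x)) v)"

definition q1 :: "coeffs \<Rightarrow> real \<Rightarrow> real^3 \<Rightarrow> real^3 \<Rightarrow> 3 \<Rightarrow> 3 \<Rightarrow> real" where
  "q1 fb t x v \<sigma> \<gamma> =
     - (\<Sum>\<alpha>\<in>UNIV. \<Sum>\<beta>\<in>UNIV. f2_inv fb t x \<sigma> \<beta> * f2_inv fb t x \<alpha> \<gamma> *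
          (fb 1 [\<alpha>, \<beta>] t x + (\<Sum>\<alpha>1\<in>UNIV. fb 0 [\<alpha>, \<beta>, \<alpha>1] t x * v $ \<alpha>1)))"

definition q2 :: "coeffs \<Rightarrow> real \<Rightarrow> real^3 \<Rightarrow> real^3 \<Rightarrow> 3 \<Rightarrow> 3 \<Rightarrow> real" where
  "q2 fb t x v \<sigma> \<gamma> =
     (\<Sum>\<alpha>\<in>UNIV. \<Sum>l\<in>UNIV. fb 0 [\<alpha>, l] t x * q1 fb t x v \<alpha> \<gamma> * q1 fb t x v \<sigma> l)
     - (\<Sum>\<alpha>\<in>UNIV. \<Sum>\<beta>\<in>UNIV. f2_inv fb t x \<sigma> \<beta> * f2_inv fb t x \<alpha> \<gamma> *
          (fb 2 [\<alpha>, \<beta>] t x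
           + (\<Sum>\<alpha>1\<in>UNIV. fb 1 [\<alpha>, \<beta>, \<alpha>1] t x * v $ \<alpha>1)
           + 1 / 2 * (\<Sum>\<alpha>1\<in>UNIV. \<Sum>\<alpha>2\<in>UNIV.
               fb 0 [\<alpha>, \<beta>, \<alpha>1, \<alpha>2] t x * v $ \<alpha>1 * v $ \<alpha>2)))"

end

theory Submission
  imports Defs
begin

text \<open>
  In powers of \<open>1/c\<close> the equation reads \<open>A a = R\<close>, where \<open>A = \<Sum>\<^sub>i A\<^sub>i c\<^sup>-\<^sup>i\<close> has the
  invertible leading term \<open>A\<^sub>0 = f2_matrix\<close> and the coefficient of \<open>c\<^sup>-\<^sup>n\<close> in \<open>R\<close> is
  \<open>G\<^sup>(\<^sup>n\<^sup>)\<close>. Comparing lowest coefficients, \<open>A w\<close> has the same order in \<open>1/c\<close> as \<open>w\<close>; hence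
  \<open>A\<close> is injective, so invertible over the field of Laurent series, and the solution starts
  at order \<open>0\<close> because \<open>R\<close> does. The coefficients then follow by solving
  \<open>\<Sum>\<^sub>i A\<^sub>i a\<^sub>n\<^sub>-\<^sub>i = G\<^sup>(\<^sup>n\<^sup>)\<close> successively for \<open>n = 0, 1, 2\<close>.
\<close>


no_notation fps_nth (infixl \<open>$\<close> 75)

section \<open>Contraction of index lists with a vector\<close>

lemma contract_0 [simp]: "contract 0 T v = T []"
  by (simp add: contract_def)

text \<open>Splitting off the head of the index list is what permits induction on the rank.\<close>

lemma contract_Suc: "contract (Suc I) T v = (\<Sum>\<alpha>\<in>UNIV. v $ \<alpha> * contract I (\<lambda>as. T (\<alpha> # as)) v)"
proof -
  have lists: "{as :: 3 list. length as = Suc I} = (\<lambda>(as, \<alpha>). \<alpha> # as) ` ({as. length as = I} \<times> UNIV)"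
    using lists_length_Suc_eq [of "UNIV :: 3 set" I] by simp
  have "contract (Suc I) T v = (\<Sum>(as, \<alpha>) \<in> {as. length as = I} \<times> UNIV. T (\<alpha> # as) * (\<Prod>\<beta>\<leftarrow>\<alpha> # as. v $ \<beta>))"
    unfolding contract_def lists
    by (subst sum.reindex) (auto simp: inj_on_def case_prod_unfold)
  also have "\<dots> = (\<Sum>\<alpha>\<in>UNIV. \<Sum>as | length as = I. T (\<alpha> # as) * (\<Prod>\<beta>\<leftarrow>\<alpha> # as. v $ \<beta>))"
    by (subst sum.swap) (simp add: sum.cartesian_product)
  finally show ?thesis
    by (simp add: contract_def sum_distrib_left mult_ac)
qed

lemma contract_add: "contract I (\<lambda>as. T as + T' as) v = contract I T v + contract I T' v"
  by (simp add: contract_def sum.distrib distrib_right)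

lemma contract_cmult: "contract I (\<lambda>as. k * T as) v = k * contract I T v"
  by (simp add: contract_def sum_distrib_left mult_ac)

lemma contract_sum: "contract I (\<lambda>as. \<Sum>i\<in>S. T i as) v = (\<Sum>i\<in>S. contract I (T i) v)"
  unfolding contract_def sum_distrib_right by (rule sum.swap)

lemma DERIV_contract:
  assumes "\<And>as. ((\<lambda>s. T s as) has_real_derivative T' as) (at s0)"
  shows "((\<lambda>s. contract I (T s) v) has_real_derivative contract I T' v) (at s0)"
  unfolding contract_def by (intro DERIV_sum DERIV_cmult_right assms)

text \<open>By symmetry all \<open>I\<close> slots contribute equally. In the induction step the
  product rule yields one term from the leading slot and \<open>I\<close> equal terms from the
  others, where symmetry brings \<open>\<beta>\<close> to the front. For rank 0 the truncated
  \<open>I - 1\<close> is harmless, as the factor \<open>real I\<close> vanishes.\<close>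

lemma DERIV_contract_axis:
  assumes "\<And>as bs. mset as = mset bs \<Longrightarrow> T as = T bs"
  shows "((\<lambda>s. contract I T (v + s *\<^sub>R axis \<beta> 1)) has_real_derivative
           real I * contract (I - 1) (\<lambda>as. T (\<beta> # as)) v) (at 0)"
  using assms
proof (induction I arbitrary: T)
  case 0
  show ?case by simp
next
  case (Suc I)
  have sym: "T (\<alpha> # \<beta> # as) = T (\<beta> # \<alpha> # as)" for \<alpha> as
    by (rule Suc.prems) simp
  have ax: "(\<Sum>\<alpha>\<in>UNIV. axis \<beta> 1 $ \<alpha> * h \<alpha>) = h \<beta>" for h :: "3 \<Rightarrow> real"
  proof -
    have "(\<Sum>\<alpha>\<in>UNIV. axis \<beta> 1 $ \<alpha> * h \<alpha>) = (\<Sum>\<alpha>\<in>UNIV. if \<alpha> = \<beta> then h \<alpha> else 0)"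
      by (intro sum.cong) (auto simp: axis_def)
    then show ?thesis by simp
  qed
  have IH: "((\<lambda>s. contract I (\<lambda>as. T (\<alpha> # as)) (v + s *\<^sub>R axis \<beta> 1)) has_real_derivative
      real I * contract (I - 1) (\<lambda>as. T (\<alpha> # \<beta> # as)) v) (at 0)" for \<alpha>
    by (intro Suc.IH Suc.prems) simp
  \<comment> \<open>Both sides vanish for \<open>I = 0\<close>; otherwise the sum over
    \<open>\<alpha>\<close> reassembles a contraction of rank \<open>I\<close> once
    \<open>\<alpha>\<close> and \<open>\<beta>\<close> are exchanged.\<close>
  have I: "real I * (\<Sum>\<alpha>\<in>UNIV. v $ \<alpha> * contract (I - 1) (\<lambda>as. T (\<alpha> # \<beta> # as)) v)
      = real I * contract I (\<lambda>as. T (\<beta> # as)) v"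
    by (cases I) (simp_all add: contract_Suc sym)
  have "((\<lambda>s. \<Sum>\<alpha>\<in>UNIV. (v $ \<alpha> + s * axis \<beta> 1 $ \<alpha>) * contract I (\<lambda>as. T (\<alpha> # as)) (v + s *\<^sub>R axis \<beta> 1))
     has_real_derivative (\<Sum>\<alpha>\<in>UNIV. axis \<beta> 1 $ \<alpha> * contract I (\<lambda>as. T (\<alpha> # as)) v
        + v $ \<alpha> * (real I * contract (I - 1) (\<lambda>as. T (\<alpha> # \<beta> # as)) v))) (at 0)"
    by (rule DERIV_sum) (rule derivative_eq_intros IH refl | simp)+
  also have "(\<Sum>\<alpha>\<in>UNIV. axis \<beta> 1 $ \<alpha> * contract I (\<lambda>as. T (\<alpha> # as)) v
        + v $ \<alpha> * (real I * contract (I - 1) (\<lambda>as. T (\<alpha> # \<beta> # as)) v))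
     = real (Suc I) * contract I (\<lambda>as. T (\<beta> # as)) v"
    using I by (simp add: sum.distrib ax sum_distrib_left algebra_simps)
  finally show ?case by (simp add: contract_Suc)
qed

section \<open>Term-by-term derivatives of the expansion\<close>

text \<open>The factor \<open>Suc I\<close> produced by the derivative reduces
  \<open>fact (Suc I)\<close> to \<open>fact I\<close>. The result is again an expansion of the
  assumed shape, so the lemma can be applied twice to reach the Hessian.\<close>

lemma d_eps_expansion:
  assumes "\<And>J I s y \<epsilon>. \<phi> J I s y \<epsilon> = 1 / fact I * contract I (\<lambda>as. T J as s y) \<epsilon>"
    and "totally_symmetric T"
  shows "d_eps \<beta> \<phi> J I s y \<epsilon> = 1 / fact I * contract I (\<lambda>as. T J (\<beta> # as) s y) \<epsilon>"
proof -
  have fact: "1 / fact (Suc I) * (real (Suc I) * c) = 1 / fact I * c" for c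
    by (simp add: fact_Suc del: of_nat_Suc)
  have "((\<lambda>r. 1 / fact (Suc I) * contract (Suc I) (\<lambda>as. T J as s y) (\<epsilon> + r *\<^sub>R axis \<beta> 1))
     has_real_derivative 1 / fact (Suc I) * (real (Suc I) * contract I (\<lambda>as. T J (\<beta> # as) s y) \<epsilon>)) (at 0)"
    using assms(2) DERIV_contract_axis [of "\<lambda>as. T J as s y" "Suc I"]
    unfolding totally_symmetric_def diff_Suc_1 by (intro DERIV_cmult) blast
  then show ?thesis
    unfolding d_eps_def partial_deriv_def assms(1) fact by (rule DERIV_imp_deriv)
qed

lemma totally_symmetric_Cons:
  "totally_symmetric T \<Longrightarrow> totally_symmetric (\<lambda>J as. T J (\<alpha> # as))"
  by (simp add: totally_symmetric_def)

text \<open>Chain rule along an affine path. As \<open>deriv\<close> is defined by choice, it obeys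
  the rules of calculus only where a derivative exists; joint differentiability at
  \<open>(t, x)\<close> supplies this, here for space and in \<open>DERIV_time\<close> for
  time.\<close>

lemma DERIV_axis:
  assumes "(\<lambda>(s, y). h s y) differentiable (at (t, x))"
  shows "((\<lambda>r. h t (x + r *\<^sub>R axis \<alpha> 1)) has_real_derivative partial_deriv \<alpha> (h t) x) (at 0)"
proof -
  have "(\<lambda>r. (t, x + r *\<^sub>R axis \<alpha> 1)) differentiable (at (0 :: real))"
    by (intro derivative_intros differentiable_Pair) 
  then have "(\<lambda>(s, y). h s y) \<circ> (\<lambda>r. (t, x + r *\<^sub>R axis \<alpha> 1)) differentiable (at 0)"
    using assms by (intro differentiable_chain_at) auto
  then show ?thesis
    by (simp add: o_def partial_deriv_def DERIV_deriv_iff_real_differentiable)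
qed

lemma DERIV_time:
  assumes "(\<lambda>(s, y). h s y) differentiable (at (t, x))"
  shows "((\<lambda>s. h s x) has_real_derivative deriv (\<lambda>s. h s x) t) (at t)"
proof -
  have "(\<lambda>s. (s, x)) differentiable (at t)"
    by (intro derivative_intros differentiable_Pair) 
  then have "(\<lambda>(s, y). h s y) \<circ> (\<lambda>s. (s, x)) differentiable (at t)"
    using assms by (intro differentiable_chain_at) auto
  then show ?thesis
    by (simp add: o_def DERIV_deriv_iff_real_differentiable)
qed

lemma d_x_expansion:
  assumes "\<And>J I s y \<epsilon>. \<phi> J I s y \<epsilon> = 1 / fact I * contract I (\<lambda>as. T J as s y) \<epsilon>"
    and "\<And>J as. (\<lambda>(s, y). T J as s y) differentiable (at (t, x))"
  shows "d_x \<alpha> \<phi> J I t x \<epsilon> = 1 / fact I * contract I (\<lambda>as. partial_deriv \<alpha> (T J as t) x) \<epsilon>"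
  unfolding d_x_def assms(1) 
  \<comment> \<open>\<open>subst\<close> unfolds only the outer \<open>partial_deriv\<close>; the
    one under the contraction stays folded to match \<open>DERIV_axis\<close>.\<close>
  by (subst partial_deriv_def, intro DERIV_imp_deriv DERIV_cmult DERIV_contract DERIV_axis assms(2))

lemma d_t_expansion:
  assumes "\<And>J I s y \<epsilon>. \<phi> J I s y \<epsilon> = 1 / fact I * contract I (\<lambda>as. T J as s y) \<epsilon>"
    and "\<And>J as. (\<lambda>(s, y). T J as s y) differentiable (at (t, x))"
  shows "d_t \<phi> J I t x \<epsilon> = 1 / fact I * contract I (\<lambda>as. deriv (\<lambda>s. T J as s x) t) \<epsilon>"
  unfolding d_t_def assms(1) 
  by (intro DERIV_imp_deriv DERIV_cmult DERIV_contract DERIV_time assms(2))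


section \<open>Coefficients of products of Laurent series in 1/c\<close>

text \<open>The index set is empty for negative \<open>n\<close>, so one formula serves all integer
  orders and has the shape of the sums in \<open>G\<close>.\<close>

lemma at_velocity_nth:
  "fls_nth (at_velocity \<phi> t x v) n = (\<Sum>I | int I \<le> n. \<phi> (nat (n - int I)) I t x v)"
proof (cases "n < 0")
  case False
  then have "{I. int I \<le> n} = {..nat n}" by auto
  with False show ?thesis
    by (simp add: at_velocity_def nat_diff_distrib)
qed (auto simp: at_velocity_def intro: sum.neutral)

text \<open>Shifting \<open>w\<close> by its order bound \<open>m\<close> makes it a power series,
  for which the Cauchy product is a finite sum.\<close>

lemma fls_nth_fps_to_fls_mult:
  fixes P :: "'a::comm_ring_1 fps"
  assumes "\<And>k. k < m \<Longrightarrow> fls_nth w k = 0"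
  shows "fls_nth (fps_to_fls P * w) (m + int n) = (\<Sum>i\<le>n. fps_nth P i * fls_nth w (m + int (n - i)))"
proof -
  define W where "W = Abs_fps (\<lambda>n. fls_nth w (m + int n))"
  have "w = fls_shift (- m) (fps_to_fls W)"
    by (intro fls_eqI) (simp add: W_def assms)
  then have "fps_to_fls P * w = fls_shift (- m) (fps_to_fls (P * W))"
    by (simp add: fls_shifted_times_simps fls_times_fps_to_fls)
  then show ?thesis
    by (simp add: fps_mult_nth W_def atLeast0AtMost)
qed

text \<open>Exchanging the sum over components with the sum over orders leaves one real
  matrix-vector product per order. Both the cancellation of orders and the recursion for the
  solution rest on this form.\<close>

lemma fls_matrix_vector_nth:
  fixes M :: "'a::comm_ring_1 fps^'n^'m" and w :: "'a fls^'n"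
  assumes "\<And>\<alpha> k. k < m \<Longrightarrow> fls_nth (w $ \<alpha>) k = 0"
  shows "(\<chi> \<beta>. fls_nth (((\<chi> \<beta> \<alpha>. fps_to_fls (M $ \<beta> $ \<alpha>)) *v w) $ \<beta>) (m + int n)) =
     (\<Sum>i\<le>n. (\<chi> \<beta> \<alpha>. fps_nth (M $ \<beta> $ \<alpha>) i) *v (\<chi> \<alpha>. fls_nth (w $ \<alpha>) (m + int (n - i))))"
proof -
  have "fls_nth (\<Sum>\<alpha>\<in>UNIV. fps_to_fls (M $ \<beta> $ \<alpha>) * w $ \<alpha>) (m + int n)
     = (\<Sum>i\<le>n. \<Sum>\<alpha>\<in>UNIV. fps_nth (M $ \<beta> $ \<alpha>) i * fls_nth (w $ \<alpha>) (m + int (n - i)))" for \<beta>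
    unfolding fls_nth_sum by (subst sum.swap) (intro sum.cong refl fls_nth_fps_to_fls_mult assms)
  then show ?thesis
    by (simp add: vec_eq_iff matrix_vector_mult_def)
qed

lemma is_O_c_matrix_vector_cancel:
  fixes M :: "real fps^'n^'n" and w :: "real fls^'n"
  assumes inv: "invertible (\<chi> \<beta> \<alpha>. fps_nth (M $ \<beta> $ \<alpha>) 0)"
    and O: "\<And>\<beta>. is_O_c k (((\<chi> \<beta> \<alpha>. fps_to_fls (M $ \<beta> $ \<alpha>)) *v w) $ \<beta>)"
  shows "is_O_c k (w $ \<alpha>)"
proof -
  have "\<exists>N. \<forall>n<N. fls_nth (w $ \<alpha>) n = 0" for \<alpha>
    by (meson fls_nth_vanishes_belowE)
  then obtain N where N: "\<And>\<alpha> n. n < N \<alpha> \<Longrightarrow> fls_nth (w $ \<alpha>) n = 0"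
    by metis
  \<comment> \<open>capping by \<open>k\<close> makes the induction from \<open>l\<close> reach \<open>k\<close>\<close>
  define l where "l = min k (Min (range N))"
  \<comment> \<open>The bound on \<open>m\<close> belongs to the induction predicate because
    \<open>O\<close> controls only the orders below \<open>k\<close>.\<close>
  have "m \<le> k \<longrightarrow> (\<forall>\<alpha>. \<forall>n<m. fls_nth (w $ \<alpha>) n = 0)" if "l \<le> m" for m
    using that
  proof (induction m rule: int_ge_induct)
    case base
    have "l \<le> N \<alpha>" for \<alpha> by (auto simp: l_def min_le_iff_disj)
    then show ?case by (intro impI allI N) (rule less_le_trans)
  next
    case (step m)
    show ?case
    proof (intro impI allI)
      fix \<alpha> n assume "m + 1 \<le> k" "n < m + 1"
      then have IH: "fls_nth (w $ \<alpha>) n = 0" if "n < m" for \<alpha> n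
        using step that by auto
      \<comment> \<open>Since \<open>w\<close> vanishes below order \<open>m\<close>, the product at
        that order consists of the leading matrix term alone.\<close>
      have "(\<chi> \<beta> \<alpha>. fps_nth (M $ \<beta> $ \<alpha>) 0) *v (\<chi> \<alpha>. fls_nth (w $ \<alpha>) m) = 0"
        using fls_matrix_vector_nth [of m w M 0] IH O \<open>m + 1 \<le> k\<close>
        by (simp add: is_O_c_def vec_eq_iff)
      then have "(\<chi> \<alpha>. fls_nth (w $ \<alpha>) m) = 0"
        using inv by (metis invertible_left_inverse matrix_left_invertible_ker)
      then show "fls_nth (w $ \<alpha>) n = 0"
        using IH \<open>n < m + 1\<close> by (cases "n = m") (auto simp: vec_eq_iff)
    qed
  qed
  from this [of k] show ?thesis
    by (simp add: is_O_c_def l_def)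
qed

text \<open>Laurent series form a field, so a trivial kernel suffices; a kernel vector vanishes to
  every order \<open>k\<close>, hence is zero.\<close>

lemma invertible_fps_to_fls_matrix:
  fixes M :: "real fps^'n^'n"
  assumes "invertible (\<chi> \<beta> \<alpha>. fps_nth (M $ \<beta> $ \<alpha>) 0)"
  shows "invertible (\<chi> \<beta> \<alpha>. fps_to_fls (M $ \<beta> $ \<alpha>))"
  unfolding invertible_left_inverse matrix_left_invertible_ker
proof (intro allI impI)
  fix w :: "real fls^'n"
  assume w: "(\<chi> \<beta> \<alpha>. fps_to_fls (M $ \<beta> $ \<alpha>)) *v w = 0"
  have "is_O_c k (w $ \<alpha>)" for k \<alpha>
  proof (rule is_O_c_matrix_vector_cancel [OF assms])
    show "is_O_c k (((\<chi> \<beta> \<alpha>. fps_to_fls (M $ \<beta> $ \<alpha>)) *v w) $ \<beta>)" for \<beta>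
      unfolding w by (simp add: is_O_c_def)
  qed
  then have "fls_nth (w $ \<alpha>) n = 0" for \<alpha> n
    unfolding is_O_c_def by (meson less_add_one)
  then show "w = 0"
    by (simp add: vec_eq_iff fls_eq_iff)
qed

text \<open>The prefactors \<open>c^2\<close> and \<open>c\<close> shift the order by 2 and 1, which
  accounts for the offsets \<open>J + 2\<close> and \<open>J + 1\<close> in \<open>G\<close>. The
  velocity components do not depend on the order and can be moved inside the contraction.\<close>

lemma force_nth:
  assumes expansion: "\<And>J I s y \<epsilon>. f J I s y \<epsilon> = 1 / fact I * contract I (\<lambda>as. fb J as s y) \<epsilon>"
    and sym: "totally_symmetric fb"
    and diff: "\<And>J as. (\<lambda>(s, y). fb J as s y) differentiable (at (t, x))"
  shows "fls_nth (fls_X_inv ^ 2 * at_velocity (d_x \<beta> f) t x v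
        - fls_X_inv * (at_velocity (d_t (d_eps \<beta> f)) t x v
            + (\<Sum>\<gamma>\<in>UNIV. fls_const (v $ \<gamma>) * at_velocity (d_x \<gamma> (d_eps \<beta> f)) t x v))) n
    = G fb t x v n \<beta>"
proof -
  note e = d_eps_expansion [where T = fb and \<beta> = \<beta>, OF expansion sym]
  have x: "d_x \<beta> f J I t x v = 1 / fact I * contract I (\<lambda>as. partial_deriv \<beta> (fb J as t) x) v" for J I
    by (rule d_x_expansion [OF expansion diff])
  have tx: "d_t (d_eps \<beta> f) J I t x v + (\<Sum>\<gamma>\<in>UNIV. v $ \<gamma> * d_x \<gamma> (d_eps \<beta> f) J I t x v) =
     1 / fact I * contract I (\<lambda>as. deriv (\<lambda>s. fb J (\<beta> # as) s x) t
        + (\<Sum>\<gamma>\<in>UNIV. v $ \<gamma> * partial_deriv \<gamma> (fb J (\<beta> # as) t) x)) v" for J I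
    unfolding d_x_expansion [where T = "\<lambda>J as. fb J (\<beta> # as)", OF e diff]
      d_t_expansion [where T = "\<lambda>J as. fb J (\<beta> # as)", OF e diff]
    by (simp add: contract_add contract_sum contract_cmult sum_distrib_left add_divide_distrib sum_divide_distrib)
  \<comment> \<open>Index set and upper label are left arbitrary so that the equation matches the
    shifted sums delivered by \<open>at_velocity_nth\<close>.\<close>
  have sums: "(\<Sum>I\<in>S. d_t (d_eps \<beta> f) (J I) I t x v)
      + (\<Sum>\<gamma>\<in>UNIV. v $ \<gamma> * (\<Sum>I\<in>S. d_x \<gamma> (d_eps \<beta> f) (J I) I t x v))
    = (\<Sum>I\<in>S. 1 / fact I * contract I (\<lambda>as. deriv (\<lambda>s. fb (J I) (\<beta> # as) s x) t
        + (\<Sum>\<gamma>\<in>UNIV. v $ \<gamma> * partial_deriv \<gamma> (fb (J I) (\<beta> # as) t) x)) v)" for S and J :: "nat \<Rightarrow> nat"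
    unfolding tx [symmetric] sum.distrib sum_distrib_left by (subst (2) sum.swap) (rule refl)
  show ?thesis
    unfolding G_def fls_minus_nth fls_plus_nth fls_X_inv_power_times_conv_shift fls_X_inv_times_conv_shift
      fls_shift_nth fls_nth_sum fls_mult_const_nth at_velocity_nth x sums
    by (simp add: algebra_simps)
qed


section \<open>Inverse matrices and the solution order by order\<close>

lemma matrix_inv_inverse:
  fixes A :: "'a::semiring_1^'n^'m"
  assumes "invertible A"
  shows "A ** matrix_inv A = mat 1" "matrix_inv A ** A = mat 1"
  using someI_ex [OF assms [unfolded invertible_def]] by (simp_all add: matrix_inv_def)

lemma matrix_vector_eq_iff_matrix_inv:
  fixes A :: "'a::comm_semiring_1^'n^'m"
  assumes "invertible A"
  shows "A *v u = w \<longleftrightarrow> u = matrix_inv A *v w"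
  using matrix_inv_inverse [OF assms]
  by (auto simp: matrix_vector_mul_assoc)

lemma minus_matrix_vector_mult: "(- A) *v u = - (A *v u)" for A :: "real^'n^'m"
  using matrix_vector_mult_diff_rdistrib [of 0 A u] by simp

text \<open>\<open>V\<close>, \<open>Q1\<close> and \<open>Q2\<close> are the first three
  coefficients of the inverse of the series \<open>A\<close>. The usual term
  \<open>V ** A 1 ** V ** A 1 ** V\<close> of the second one is written as
  \<open>Q1 ** A 0 ** Q1\<close>, the form that \<open>q2\<close> has.\<close>

lemma fls_matrix_solution_coeffs:
  fixes M :: "real fps^'n^'n" and w r :: "real fls^'n"
  defines "A \<equiv> \<lambda>i. \<chi> \<beta> \<alpha>. fps_nth (M $ \<beta> $ \<alpha>) i" and "R \<equiv> \<lambda>n. \<chi> \<beta>. fls_nth (r $ \<beta>) (int n)"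
    and "W \<equiv> \<lambda>n. \<chi> \<beta>. fls_nth (w $ \<beta>) (int n)"
  defines "V \<equiv> matrix_inv (A 0)"
  defines "Q1 \<equiv> - (V ** A 1 ** V)"
  defines "Q2 \<equiv> Q1 ** A 0 ** Q1 - V ** A 2 ** V"
  assumes inv: "invertible (A 0)"
    and w: "(\<chi> \<beta> \<alpha>. fps_to_fls (M $ \<beta> $ \<alpha>)) *v w = r"
    and O: "\<And>\<beta>. is_O_c 0 (r $ \<beta>)"
  shows "is_O_c 0 (w $ \<beta>)"
    and "W 0 = V *v R 0"
    and "W 1 = V *v R 1 + Q1 *v R 0"
    and "W 2 = V *v R 2 + Q1 *v R 1 + Q2 *v R 0"
proof -
  show O_w: "is_O_c 0 (w $ \<alpha>)" for \<alpha>
    by (rule is_O_c_matrix_vector_cancel [OF inv [unfolded A_def]]) (simp add: w O)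
  have R: "R n = (\<Sum>i\<le>n. A i *v W (n - i))" for n
    using fls_matrix_vector_nth [of 0 w M n] O_w
    by (simp add: w A_def R_def W_def is_O_c_def)
  have V: "V *v (A 0 *v u) = u" for u
    using matrix_inv_inverse(2) [OF inv] by (simp add: V_def matrix_vector_mul_assoc)
  have Q1: "Q1 *v u = - (V *v (A 1 *v (V *v u)))" for u
    by (simp add: Q1_def minus_matrix_vector_mult matrix_vector_mul_assoc matrix_mul_assoc)
  show W0: "W 0 = V *v R 0"
    by (simp add: R V)
  have "R 1 = A 0 *v W 1 + A 1 *v W 0"
    by (simp add: R)
  \<comment> \<open>The bracket equals \<open>A 0 *v W 1\<close>, and \<open>V\<close> cancels
    \<open>A 0\<close>.\<close>
  then have "V *v (R 1 - A 1 *v W 0) = W 1"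
    by (simp add: V)
  then show W1: "W 1 = V *v R 1 + Q1 *v R 0"
    by (simp add: W0 Q1 algebra_simps)
  have "R 2 = A 0 *v W 2 + A 1 *v W 1 + A 2 *v W 0"
    by (simp add: R numeral_2_eq_2)
  then have W2: "W 2 = V *v (R 2 - A 1 *v W 1 - A 2 *v W 0)"
    by (simp add: V)
  have Q2: "Q2 *v u = Q1 *v (A 0 *v (Q1 *v u)) - V *v (A 2 *v (V *v u))" for u
    by (simp add: Q2_def matrix_vector_mult_diff_rdistrib matrix_vector_mul_assoc matrix_mul_assoc)
  show "W 2 = V *v R 2 + Q1 *v R 1 + Q2 *v R 0"
    \<comment> \<open>The \<open>A 0\<close> between the two factors \<open>Q1\<close> meets a
      \<open>V\<close> and drops out.\<close>
    unfolding W2 W1 W0 Q1 Q2 V vec.neg by (simp add: V vec.neg algebra_simps)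
qed

section \<open>Hessian coefficients and symmetry of the inverse\<close>

text \<open>The index of the inner derivative comes first in the list, so the equation index
  \<open>\<beta>\<close> becomes the row index of the system.\<close>

lemma at_velocity_hessian:
  assumes expansion: "\<And>J I s y \<epsilon>. f J I s y \<epsilon> = 1 / fact I * contract I (\<lambda>as. fb J as s y) \<epsilon>"
    and sym: "totally_symmetric fb"
  shows "at_velocity (d_eps \<alpha> (d_eps \<beta> f)) t x v =
    fps_to_fls (Abs_fps (\<lambda>n. \<Sum>I\<le>n. 1 / fact I * contract I (\<lambda>as. fb (n - I) (\<beta> # \<alpha> # as) t x) v))"
  unfolding at_velocity_def
    d_eps_expansion [where T = "\<lambda>J as. fb J (\<beta> # as)",
      OF d_eps_expansion [where T = fb, OF expansion sym] totally_symmetric_Cons [OF sym]] ..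

lemma f2_matrix_symmetric: "totally_symmetric fb \<Longrightarrow> transpose (f2_matrix fb t x) = f2_matrix fb t x"
  unfolding totally_symmetric_def transpose_def f2_matrix_def
  by (simp add: vec_eq_iff)

text \<open>A left inverse and a right inverse of \<open>transpose A\<close> coincide.\<close>

lemma transpose_matrix_inv:
  fixes A :: "real^'n^'n"
  assumes "invertible A"
  shows "transpose (matrix_inv A) = matrix_inv (transpose A)"
proof -
  let ?V = "matrix_inv A" and ?W = "matrix_inv (transpose A)"
  have "transpose ?V ** transpose A = mat 1"
    by (simp add: matrix_inv_inverse [OF assms] flip: matrix_transpose_mul)
  moreover have "transpose A ** ?W = mat 1"
    using assms by (intro matrix_inv_inverse) (rule transpose_invertible)
  ultimately show ?thesis
    by (metis matrix_mul_assoc matrix_mul_lid matrix_mul_rid)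
qed

text \<open>Needed because \<open>G\<close> is contracted with the first index of
  \<open>f2_inv\<close>, while a matrix-vector product sums over the second.\<close>

lemma f2_inv_commute:
  assumes "totally_symmetric fb" "invertible (f2_matrix fb t x)"
  shows "f2_inv fb t x \<alpha> \<beta> = f2_inv fb t x \<beta> \<alpha>"
proof -
  have "transpose (matrix_inv (f2_matrix fb t x)) = matrix_inv (f2_matrix fb t x)"
    by (simp add: transpose_matrix_inv assms f2_matrix_symmetric)
  then show ?thesis
    by (simp add: f2_inv_def transpose_def vec_eq_iff)
qed

section \<open>The acceleration up to order 1/c^2\<close>

theorem mainTheorem3:
  fixes F :: formal_lagrangian and f :: formal_fun and fb :: coeffs
    and t :: real and x v :: "real^3"
  assumes hom: "pos_homogeneous F"
    and f_def: "f = spatial_lagrangian F"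
    and expansion: "\<And>J I s y \<epsilon>. f J I s y \<epsilon> = 1 / fact I * contract I (\<lambda>as. fb J as s y) \<epsilon>"
    and sym: "totally_symmetric fb"
    and diff: "\<And>J as. (\<lambda>(s, y). fb J as s y) differentiable (at (t, x))"
    and inv: "invertible (f2_matrix fb t x)"
    and Gm2: "\<And>\<alpha>. G fb t x v (- 2) \<alpha> = 0"
    and Gm1: "\<And>\<alpha>. G fb t x v (- 1) \<alpha> = 0"
  shows "\<exists>g :: (real fls)^3.
    (\<forall>a. acceleration_eq f t x v a \<longleftrightarrow> a = g) \<and>
    (\<forall>\<beta>. is_O_c 3 (g $ \<beta> -
      (fls_const (\<Sum>\<alpha>\<in>UNIV. f2_inv fb t x \<alpha> \<beta> * G fb t x v 0 \<alpha>)
       + fls_X * fls_const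
           (\<Sum>\<alpha>\<in>UNIV. f2_inv fb t x \<alpha> \<beta> * G fb t x v 1 \<alpha>
                    + q1 fb t x v \<alpha> \<beta> * G fb t x v 0 \<alpha>)
       + fls_X ^ 2 * fls_const
           (\<Sum>\<alpha>\<in>UNIV. f2_inv fb t x \<alpha> \<beta> * G fb t x v 2 \<alpha>
                    + q1 fb t x v \<alpha> \<beta> * G fb t x v 1 \<alpha>
                    + q2 fb t x v \<alpha> \<beta> * G fb t x v 0 \<alpha>))))"
proof -
  define M :: "real fps^3^3" where "M = (\<chi> \<beta> \<alpha>. Abs_fps (\<lambda>n. \<Sum>I\<le>n. 1 / fact I *
    contract I (\<lambda>as. fb (n - I) (\<beta> # \<alpha> # as) t x) v))"
  define R :: "real fls^3" where "R = (\<chi> \<beta>. fls_X_inv ^ 2 * at_velocity (d_x \<beta> f) t x v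
        - fls_X_inv * (at_velocity (d_t (d_eps \<beta> f)) t x v
            + (\<Sum>\<gamma>\<in>UNIV. fls_const (v $ \<gamma>) * at_velocity (d_x \<gamma> (d_eps \<beta> f)) t x v)))"
  let ?L = "\<chi> \<beta> \<alpha>. fps_to_fls (M $ \<beta> $ \<alpha>)"
  let ?A = "\<lambda>i. \<chi> \<beta> \<alpha>. fps_nth (M $ \<beta> $ \<alpha>) i"
  let ?V = "matrix_inv (f2_matrix fb t x)"
  have eq: "acceleration_eq f t x v a \<longleftrightarrow> ?L *v a = R" for a
    unfolding acceleration_eq_def at_velocity_hessian [OF expansion sym]
    by (simp add: M_def R_def vec_eq_iff matrix_vector_mult_def)
  have R: "fls_nth (R $ \<beta>) n = G fb t x v n \<beta>" for n \<beta>
    unfolding R_def vec_lambda_beta by (rule force_nth [OF expansion sym diff])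
  have O: "is_O_c 0 (R $ \<beta>)" for \<beta>
    unfolding is_O_c_def R
  proof (intro allI impI)
    fix n :: int assume "n < 0"
    \<comment> \<open>Orders -1 and -2 vanish by \<open>Gm1\<close> and \<open>Gm2\<close>; below -2
      both index sets in \<open>G\<close> are empty.\<close>
    then consider "n = - 1" | "n = - 2" | "n < - 2" by linarith
    then show "G fb t x v n \<beta> = 0"
    proof cases
      case 3
      then have "{I. int I \<le> n + 2} = {}" "{I. int I \<le> n + 1} = {}" by auto
      then show ?thesis by (simp add: G_def)
    qed (simp_all add: Gm1 Gm2)
  qed
  have A0: "?A 0 = f2_matrix fb t x"
    by (simp add: M_def f2_matrix_def)
  have invL: "invertible ?L"
    by (rule invertible_fps_to_fls_matrix) (simp only: A0 inv)
  define g where "g = matrix_inv ?L *v R"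
  have sol: "acceleration_eq f t x v a \<longleftrightarrow> a = g" for a
    unfolding eq g_def by (rule matrix_vector_eq_iff_matrix_inv [OF invL])
  have Lg: "?L *v g = R"
    using eq [of g] sol [of g] by simp
  note coeffs = fls_matrix_solution_coeffs [of M g R, unfolded A0, OF inv Lg O, unfolded vec_eq_iff]
  have A1: "?A 1 $ \<alpha> $ \<beta> = fb 1 [\<alpha>, \<beta>] t x + (\<Sum>\<alpha>1\<in>UNIV. fb 0 [\<alpha>, \<beta>, \<alpha>1] t x * v $ \<alpha>1)" for \<alpha> \<beta>
    by (simp add: M_def contract_Suc mult.commute)
  have A2: "?A 2 $ \<alpha> $ \<beta> = fb 2 [\<alpha>, \<beta>] t x + (\<Sum>\<alpha>1\<in>UNIV. fb 1 [\<alpha>, \<beta>, \<alpha>1] t x * v $ \<alpha>1)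
      + 1 / 2 * (\<Sum>\<alpha>1\<in>UNIV. \<Sum>\<alpha>2\<in>UNIV. fb 0 [\<alpha>, \<beta>, \<alpha>1, \<alpha>2] t x * v $ \<alpha>1 * v $ \<alpha>2)" for \<alpha> \<beta>
    by (simp add: M_def numeral_2_eq_2 contract_Suc sum_distrib_left mult_ac)
  \<comment> \<open>The indices \<gamma> and \<sigma> appear reversed: \<open>q1\<close> and
    \<open>q2\<close> at \<open>\<sigma> \<gamma>\<close> are matrix entries in row \<gamma> and
    column \<sigma>. Symmetry of \<open>?V\<close> reconciles the two orders.\<close>
  have conj: "(?V ** B ** ?V) $ \<gamma> $ \<sigma>
      = (\<Sum>\<alpha>\<in>UNIV. \<Sum>\<beta>\<in>UNIV. f2_inv fb t x \<sigma> \<beta> * f2_inv fb t x \<alpha> \<gamma> * B $ \<alpha> $ \<beta>)" for B \<gamma> \<sigma>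
    unfolding f2_inv_commute [OF sym inv, of \<sigma>] f2_inv_commute [OF sym inv, of _ \<gamma>]
    by (subst sum.swap) (simp add: matrix_matrix_mult_def f2_inv_def sum_distrib_left sum_distrib_right mult_ac)
  have Q1: "(- (?V ** ?A 1 ** ?V)) $ \<gamma> $ \<sigma> = q1 fb t x v \<sigma> \<gamma>" for \<gamma> \<sigma>
    unfolding q1_def A1 [symmetric] conj [symmetric] by simp
  have Q2: "(- (?V ** ?A 1 ** ?V) ** f2_matrix fb t x ** - (?V ** ?A 1 ** ?V) - ?V ** ?A 2 ** ?V) $ \<gamma> $ \<sigma>
      = q2 fb t x v \<sigma> \<gamma>" for \<gamma> \<sigma>
  proof -
    have "(Q ** f2_matrix fb t x ** Q) $ \<gamma> $ \<sigma>
       = (\<Sum>\<alpha>\<in>UNIV. \<Sum>l\<in>UNIV. fb 0 [\<alpha>, l] t x * Q $ \<gamma> $ \<alpha> * Q $ l $ \<sigma>)" for Q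
      by (subst sum.swap) (simp add: matrix_matrix_mult_def f2_matrix_def sum_distrib_left sum_distrib_right mult_ac)
    then show ?thesis
      unfolding q2_def A2 [symmetric] conj [symmetric] vector_minus_component Q1 [symmetric] by simp
  qed
  have V_mult: "(?V *v u) $ \<beta> = (\<Sum>\<alpha>\<in>UNIV. f2_inv fb t x \<alpha> \<beta> * u $ \<alpha>)" for u \<beta>
    unfolding f2_inv_commute [OF sym inv, of _ \<beta>] by (simp add: matrix_vector_mult_def f2_inv_def)
  \<comment> \<open>The reversed index convention yields exactly the contraction over the first
    index that the claim displays.\<close>
  have mult: "(Q *v u) $ \<beta> = (\<Sum>\<alpha>\<in>UNIV. q \<alpha> \<beta> * u $ \<alpha>)"
    if "\<And>\<gamma> \<sigma>. Q $ \<gamma> $ \<sigma> = q \<sigma> \<gamma>" for Q :: "real^3^3" and q u \<beta>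
    by (simp add: matrix_vector_mult_def that)
  note coeffs' = coeffs [unfolded vector_add_component V_mult mult [OF Q1] mult [OF Q2] vec_lambda_beta R, rule_format]
  have nth: "n = 0 \<or> n = 1 \<or> n = 2" if "\<not> n < 0" "n < 3" for n :: int
    using that by linarith
  show ?thesis
  proof (intro exI [of _ g] conjI allI sol)
    fix \<beta>
    have neg: "fls_nth (g $ \<beta>) n = 0" if "n < 0" for n
      using coeffs(1) that by (simp add: is_O_c_def)
    have "fls_nth (g $ \<beta>) 0 = (\<Sum>\<alpha>\<in>UNIV. f2_inv fb t x \<alpha> \<beta> * G fb t x v 0 \<alpha>)"
      using coeffs'(2) [of \<beta>] by simp
    moreover have "fls_nth (g $ \<beta>) 1 = (\<Sum>\<alpha>\<in>UNIV. f2_inv fb t x \<alpha> \<beta> * G fb t x v 1 \<alpha>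
        + q1 fb t x v \<alpha> \<beta> * G fb t x v 0 \<alpha>)"
      using coeffs'(3) [of \<beta>] by (simp add: sum.distrib)
    moreover have "fls_nth (g $ \<beta>) 2 = (\<Sum>\<alpha>\<in>UNIV. f2_inv fb t x \<alpha> \<beta> * G fb t x v 2 \<alpha>
        + q1 fb t x v \<alpha> \<beta> * G fb t x v 1 \<alpha> + q2 fb t x v \<alpha> \<beta> * G fb t x v 0 \<alpha>)"
      using coeffs'(4) [of \<beta>] by (simp add: sum.distrib)
    ultimately show "is_O_c 3 (g $ \<beta> -
      (fls_const (\<Sum>\<alpha>\<in>UNIV. f2_inv fb t x \<alpha> \<beta> * G fb t x v 0 \<alpha>)
       + fls_X * fls_const
           (\<Sum>\<alpha>\<in>UNIV. f2_inv fb t x \<alpha> \<beta> * G fb t x v 1 \<alpha>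
                    + q1 fb t x v \<alpha> \<beta> * G fb t x v 0 \<alpha>)
       + fls_X ^ 2 * fls_const
           (\<Sum>\<alpha>\<in>UNIV. f2_inv fb t x \<alpha> \<beta> * G fb t x v 2 \<alpha>
                    + q1 fb t x v \<alpha> \<beta> * G fb t x v 1 \<alpha>
                    + q2 fb t x v \<alpha> \<beta> * G fb t x v 0 \<alpha>)))"
      \<comment> \<open>Multiplication by a power of \<open>fls_X\<close> is a shift, so each of the
        orders 0, 1, 2 picks out exactly one of the three constants; negative orders are covered by
        \<open>neg\<close>.\<close>
      unfolding is_O_c_def fls_minus_nth fls_plus_nth fls_X_power_times_conv_shift fls_X_times_conv_shift
        fls_shift_nth fls_const_nth
      using neg nth by force
  qed
qed

end
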